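(* Let $k\in\mathbb{N}_0$, $a\in\mathbb{C}\setminus\{0,-1,-2,\ldots\}$, and let $z,s\in\mathbb{C}$ be such that the series defining $H_k(z,s,a)$ converges (that is, $|z|<1$ and $s$ arbitrary; or $z=1$ and $\operatorname{Re}(s)>3$; or $|z|=1$, $z\ne1$ and $\operatorname{Re}(s)>2$). Then $$H_k(z,s,a)=\alpha_k\Phi(z,s-2,a)+(\beta_k-2a\alpha_k)\Phi(z,s-1,a)+(1-a\beta_k+a^2\alpha_k)\Phi(z,s,a).$$
   Context: $\mathbb{N}_0=\{0,1,2,\ldots\}$. $\alpha_k=\frac32 4^k$, $\beta_k=\frac32 2^k$, and the $k$-augmented centered triangular numbers are given by $A(r+1,k)=\alpha_k r^2+\beta_k r+1$ for integers $r\ge0$. Complex powers are principal: $(r+a)^{-s}=\exp\{-s\operatorname{Log}(r+a)\}$, $-\pi<\operatorname{Arg}\le\pi$. The Hurwitz--Lerch transcendent is $\Phi(z,s,a)=\sum_{r=0}^{\infty}\frac{z^r}{(r+a)^s}$, and $H_k(z,s,a)=\sum_{r=0}^{\infty}\frac{A(r+1,k)z^r}{(r+a)^s}$. *)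

theory Defs
  imports "HOL-Analysis.Analysis"
begin

definition aug_alpha :: "nat \<Rightarrow> real" where
  "aug_alpha k = 3 / 2 * 4 ^ k"

definition aug_beta :: "nat \<Rightarrow> real" where
  "aug_beta k = 3 / 2 * 2 ^ k"

text \<open>The numbers are indexed from \<open>n = 1\<close>, so that \<open>aug_tri (r + 1) k\<close> is
  \<open>aug_alpha k * r^2 + aug_beta k * r + 1\<close>; the value at \<open>n = 0\<close> is never used.\<close>

definition aug_tri :: "nat \<Rightarrow> nat \<Rightarrow> real" where
  "aug_tri n k = aug_alpha k * (real n - 1) ^ 2 + aug_beta k * (real n - 1) + 1"

text \<open>The library's complex \<open>powr\<close> is the principal power: \<open>w powr (- s) = exp (- s * Ln w)\<close>
  for \<open>w \<noteq> 0\<close>, with \<open>Im (Ln w)\<close> in \<open>(- pi, pi]\<close>. The sums below are ordered sums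
  (\<open>suminf\<close>), because the series may converge only conditionally when \<open>cmod z = 1\<close>.\<close>

definition lerch_term :: "complex \<Rightarrow> complex \<Rightarrow> complex \<Rightarrow> nat \<Rightarrow> complex" where
  "lerch_term z s a r = z ^ r * (of_nat r + a) powr (- s)"

definition lerch_phi :: "complex \<Rightarrow> complex \<Rightarrow> complex \<Rightarrow> complex" where
  "lerch_phi z s a = (\<Sum>r. lerch_term z s a r)"

definition aug_H_term :: "nat \<Rightarrow> complex \<Rightarrow> complex \<Rightarrow> complex \<Rightarrow> nat \<Rightarrow> complex" where
  "aug_H_term k z s a r = of_real (aug_tri (r + 1) k) * z ^ r * (of_nat r + a) powr (- s)"

definition aug_H :: "nat \<Rightarrow> complex \<Rightarrow> complex \<Rightarrow> complex \<Rightarrow> complex" where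
  "aug_H k z s a = (\<Sum>r. aug_H_term k z s a r)"

end

theory Submission
  imports Defs "HOL-Real_Asymp.Real_Asymp"
begin

text \<open>
  Expanding \<open>aug_tri (r + 1) k\<close> in powers of \<open>r + a\<close> and absorbing \<open>(r + a)\<^sup>m\<close> into the
  power \<open>(r + a) powr (- s)\<close> turns every term of \<open>aug_H\<close> into the asserted linear combination
  of three Lerch terms. What remains is to decide exactly where each series converges.

  Two estimates for \<open>d r = (r + a) powr (- s)\<close> control everything. Its modulus has the exact
  order \<open>r powr (- Re s)\<close>, because the argument of \<open>r + a\<close> only contributes a bounded factor.
  It also varies slowly: \<open>d (r + 1) - d r = O(d r / r)\<close>.

  Convergence. Inside the disc, and at \<open>z = 1\<close> with large \<open>Re s\<close>, the size estimate gives absolute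
  convergence. At the other points of the unit circle, multiplication of the series by \<open>z - 1\<close>
  leaves a telescoping series minus \<open>\<Sum>r. z ^ Suc r * (d (r + 1) - d r)\<close>, which converges
  absolutely by slow variation as soon as \<open>Re s > 0\<close>; for the three Lerch series together this
  means \<open>Re s > 2\<close>.

  Divergence. For \<open>cmod z > 1\<close>, and on the unit circle for \<open>Re s \<le> 2\<close>, the terms do not tend
  to zero. The delicate range is \<open>z = 1\<close> and \<open>2 < Re s \<le> 3\<close>: the terms tend to zero, and
  for non-real \<open>s\<close> they rotate, so no comparison with a positive series applies. Slow variation
  helps again. If a slowly varying sequence \<open>c\<close> is summable, then \<open>n * c n\<close> tends to zero
  (\<open>slowly_varying_summable_imp\<close>), an analogue of Olivier's theorem on decreasing positive
  terms; here \<open>n * c n\<close> has order \<open>n powr (3 - Re s)\<close>, which does not tend to zero.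
\<close>

section \<open>Slowly varying sequences\<close>

text \<open>
  For large \<open>N\<close>, on a block \<open>N \<le> n \<le> N + N div L\<close> of length proportional to \<open>N\<close>, slow variation keeps
  \<open>c n\<close> within \<open>norm (c N) / 2\<close> of \<open>c N\<close>. The terms of a block therefore cannot
  cancel, and their sum is at least a fixed multiple of \<open>N * norm (c N)\<close>. By the Cauchy
  criterion the block sums tend to zero.
\<close>
lemma slowly_varying_summable_imp:
  fixes c :: "nat \<Rightarrow> 'a :: {real_normed_field, banach}"
  assumes sum: "summable c"
    and slow: "(\<lambda>n. c (Suc n) - c n) \<in> O(\<lambda>n. c n / of_nat n)"
  shows "(\<lambda>n. of_nat n * c n) \<longlonglongrightarrow> 0"
proof -
  obtain K where K: "K > 0"
    and "eventually (\<lambda>n. norm (c (Suc n) - c n) \<le> K * norm (c n / of_nat n)) at_top"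
    using slow by (elim landau_o.bigE)
  then obtain N0 where N0: "\<And>n. n \<ge> N0 \<Longrightarrow> norm (c (Suc n) - c n) \<le> K * (norm (c n) / n)"
    by (auto simp: eventually_at_top_linorder norm_divide)
  \<comment> \<open>The linear bound \<open>2 * K * j / N\<close> on the relative drift, proved below, is at most
      one half for \<open>j \<le> N / L\<close>.\<close>
  obtain L :: nat where L: "real L \<ge> 4 * K" using real_arch_simple by blast
  have Lpos: "L > 0" using K L by (cases L) auto
  \<comment> \<open>As long as the accumulated drift is at most \<open>norm (c N)\<close>, no term of the block exceeds
      \<open>2 * norm (c N)\<close>, so each step adds at most \<open>2 * K / N * norm (c N)\<close> to the drift.\<close>
  have near: "norm (c (N + j) - c N) \<le> 2 * K * j / N * norm (c N)"
    if N: "N \<ge> max 1 N0" and j: "2 * K * j \<le> N" for N j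
    using j
  proof (induction j)
    case (Suc j)
    have j: "2 * K * j \<le> N" using Suc.prems K by (simp add: algebra_simps)
    have "norm (c (N + j)) \<le> norm (c N) + norm (c (N + j) - c N)"
      by (metis add.commute diff_add_cancel norm_triangle_ineq)
    also have "\<dots> \<le> norm (c N) + 1 * norm (c N)"
      using Suc.IH[OF j] j N
      by (intro add_left_mono order.trans[OF Suc.IH[OF j]] mult_right_mono) auto
    finally have two: "norm (c (N + j)) \<le> 2 * norm (c N)" by simp
    have "norm (c (N + Suc j) - c (N + j)) \<le> K * (norm (c (N + j)) / real (N + j))"
      using N0[of "N + j"] N by simp
    also have "\<dots> \<le> K * (2 * norm (c N) / real N)"
      using two K N by (intro mult_left_mono frac_le) auto
    finally have "norm (c (N + Suc j) - c (N + j)) \<le> 2 * K / N * norm (c N)"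
      by (simp add: mult_ac)
    moreover have "norm (c (N + Suc j) - c N)
        \<le> norm (c (N + Suc j) - c (N + j)) + norm (c (N + j) - c N)"
      using norm_triangle_ineq[of "c (N + Suc j) - c (N + j)" "c (N + j) - c N"] by simp
    moreover have "2 * K * Suc j / N * norm (c N)
        = 2 * K / N * norm (c N) + 2 * K * j / N * norm (c N)"
      by (simp add: add_divide_distrib algebra_simps)
    ultimately show ?case using Suc.IH[OF j] by linarith
  qed auto
  have block: "real N / L * norm (c N) \<le> 2 * norm (sum c {N..<N + (N div L + 1)})"
    if N: "N \<ge> max 1 N0" for N
  proof -
    define M where "M = N div L + 1"
    have "norm (c (N + j) - c N) \<le> norm (c N) / 2" if "j < M" for j
    proof -
      have "j \<le> N div L" using that by (simp add: M_def)
      hence "j * L \<le> N" using Lpos by (simp add: less_eq_div_iff_mult_less_eq)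
      hence "real j * real L \<le> real N" by (metis of_nat_le_iff of_nat_mult)
      moreover have "real j * (4 * K) \<le> real j * real L" using L by (intro mult_left_mono) auto
      ultimately have *: "4 * K * j \<le> N" by (simp add: mult.commute)
      hence "2 * K * j / N * norm (c N) \<le> 1 / 2 * norm (c N)"
        using N by (intro mult_right_mono) (auto simp: field_simps)
      moreover have "0 \<le> K * real j" using K by simp
      ultimately show ?thesis using near[OF N, of j] * by linarith
    qed
    hence "norm (\<Sum>j<M. c (N + j) - c N) \<le> real (card {..<M}) * (norm (c N) / 2)"
      by (intro sum_norm_bound) auto
    moreover have "(\<Sum>j<M. c (N + j) - c N) = sum c {N..<N + M} - of_nat M * c N"
      using sum.shift_bounds_nat_ivl[of c 0 N M]
      by (simp add: sum_subtractf lessThan_atLeast0 add.commute)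
    moreover have "norm (of_nat M * c N) \<le> norm (sum c {N..<N + M})
        + norm (sum c {N..<N + M} - of_nat M * c N)"
      by (metis norm_triangle_sub norm_minus_commute add.commute)
    ultimately have "M * norm (c N) \<le> 2 * norm (sum c {N..<N + M})"
      by (simp add: norm_mult)
    moreover have "real N / L \<le> M"
    proof -
      have "N \<le> M * L"
        using mod_less_divisor[OF Lpos, of N] div_mult_mod_eq[of N L]
        unfolding M_def add_mult_distrib by linarith
      hence "real N \<le> real M * real L" by (metis of_nat_le_iff of_nat_mult)
      thus ?thesis using Lpos by (simp add: divide_le_eq)
    qed
    hence "real N / L * norm (c N) \<le> M * norm (c N)"
      by (rule mult_right_mono) auto
    ultimately show ?thesis unfolding M_def by linarith
  qed
  show ?thesis
  proof (rule LIMSEQ_I)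
    fix e :: real assume "e > 0"
    then obtain N1 where N1: "\<And>m n. m \<ge> N1 \<Longrightarrow> norm (sum c {m..<n}) < e / (2 * L)"
      using sum Lpos unfolding summable_Cauchy
      by (metis divide_pos_pos mult_pos_pos of_nat_0_less_iff zero_less_numeral)
    have "norm (of_nat n * c n - 0) < e" if "n \<ge> max N1 (max 1 N0)" for n
    proof -
      have "real n / L * norm (c n) < 2 * (e / (2 * L))"
        using block[of n] N1[of n] that by (smt (verit) max.bounded_iff)
      thus ?thesis using Lpos by (simp add: norm_mult field_simps)
    qed
    thus "\<exists>no. \<forall>n\<ge>no. norm (of_nat n * c n - 0) < e" by blast
  qed
qed

lemma slowly_varying_mult:
  fixes f g :: "nat \<Rightarrow> 'a :: real_normed_field"
  assumes f: "(\<lambda>n. f (Suc n) - f n) \<in> O(\<lambda>n. f n / of_nat n)"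
    and g: "(\<lambda>n. g (Suc n) - g n) \<in> O(\<lambda>n. g n / of_nat n)"
  shows "(\<lambda>n. f (Suc n) * g (Suc n) - f n * g n) \<in> O(\<lambda>n. f n * g n / of_nat n)"
proof -
  have "(\<lambda>n. f n / of_nat n) \<in> O(f)"
    by (intro bigoI[of _ 1] always_eventually)
       (auto simp: norm_divide divide_le_eq mult_le_cancel_left1)
  hence "(\<lambda>n. (f (Suc n) - f n) + f n) \<in> O(f)"
    by (intro sum_in_bigo landau_o.big.trans[OF f]) auto
  hence "(\<lambda>n. f (Suc n)) \<in> O(f)" by simp
  hence "(\<lambda>n. f (Suc n) * (g (Suc n) - g n)) \<in> O(\<lambda>n. f n * (g n / of_nat n))"
    by (intro landau_o.big.mult g)
  moreover have "(\<lambda>n. (f (Suc n) - f n) * g n) \<in> O(\<lambda>n. f n / of_nat n * g n)"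
    by (intro landau_o.big.mult f) auto
  ultimately have "(\<lambda>n. f (Suc n) * (g (Suc n) - g n) + (f (Suc n) - f n) * g n)
      \<in> O(\<lambda>n. f n * g n / of_nat n)"
    by (intro sum_in_bigo) simp_all
  thus ?thesis by (simp add: algebra_simps)
qed

section \<open>Size and variation of complex powers along a shifted progression\<close>

text \<open>
  The principal argument lies in \<open>(- pi, pi]\<close>, so the factor \<open>exp (- Im s * Arg (n + a))\<close> of the
  modulus is bounded above and bounded away from zero.
\<close>
lemma powr_shift_bigtheta:
  fixes a s :: complex
  shows "(\<lambda>n. norm ((of_nat n + a) powr s)) \<in> \<Theta>(\<lambda>n. real n powr Re s)"
proof -
  have up: "(\<lambda>n. norm (of_nat n + a)) \<in> \<Theta>(\<lambda>n. real n)"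
  proof -
    have "(\<lambda>n. norm (1 + a / of_nat n)) \<longlonglongrightarrow> norm (1 + 0 :: complex)"
      by (intro tendsto_intros lim_const_over_n)
    also have "(\<lambda>n. norm (1 + a / of_nat n)) \<longlonglongrightarrow> norm (1 + 0 :: complex) \<longleftrightarrow>
        (\<lambda>n. norm ((of_nat n + a) / of_nat n)) \<longlonglongrightarrow> norm (1 + 0 :: complex)"
      by (intro filterlim_cong refl eventually_mono[OF eventually_gt_at_top[of 0]])
         (auto simp: add_divide_distrib)
    finally have "(\<lambda>n. of_nat n + a) \<in> \<Theta>(\<lambda>n. of_nat n :: complex)"
      by (intro bigthetaI_tendsto_norm[where c = 1]) auto
    thus ?thesis using landau_theta.norm_iff[of "\<lambda>n. of_nat n + a" at_top "\<lambda>n. of_nat n"] by simp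
  qed
  have "(\<lambda>n. norm (of_nat n + a) powr Re s) \<in> \<Theta>(\<lambda>n. real n powr Re s)"
    using bigtheta_powr[OF up, of "Re s"] by simp
  moreover have "(\<lambda>n. exp (- Im s * Arg (of_nat n + a))) \<in> \<Theta>(\<lambda>_. 1 :: real)"
  proof (rule bigthetaI')
    show "0 < exp (- (\<bar>Im s\<bar> * pi))" "0 < exp (\<bar>Im s\<bar> * pi)" by auto
    have bound: "\<bar>Im s * Arg w\<bar> \<le> \<bar>Im s\<bar> * pi" for w
      using mpi_less_Arg[of w] Arg_le_pi[of w] by (auto simp: abs_mult intro!: mult_left_mono)
    show "\<forall>\<^sub>F n in at_top. exp (- (\<bar>Im s\<bar> * pi)) * norm (1::real) \<le> norm (exp (- Im s * Arg (of_nat n + a)))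
       \<and> norm (exp (- Im s * Arg (of_nat n + a))) \<le> exp (\<bar>Im s\<bar> * pi) * norm (1::real)"
      by (intro always_eventually) (use bound[unfolded abs_le_iff] in \<open>force simp: minus_le_iff\<close>)
  qed
  ultimately have "(\<lambda>n. norm (of_nat n + a) powr Re s * exp (- Im s * Arg (of_nat n + a)))
      \<in> \<Theta>(\<lambda>n. real n powr Re s * 1)"
    by (rule landau_theta.mult)
  thus ?thesis by (simp add: norm_powr_complex)
qed

text \<open>
  Once \<open>w = n + a\<close> lies in the right half-plane no branch cut is crossed, so
  \<open>(w + 1) powr s = w powr s * exp (s * Ln (1 + 1 / w))\<close>, and the exponent is \<open>O(1 / n)\<close>.
\<close>
lemma powr_shift_slowly_varying:
  fixes a s :: complex
  shows "(\<lambda>n. (of_nat (Suc n) + a) powr s - (of_nat n + a) powr s)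
           \<in> O(\<lambda>n. (of_nat n + a) powr s / of_nat n)"
proof (rule bigoI)
  show "\<forall>\<^sub>F n in at_top. norm ((of_nat (Suc n) + a) powr s - (of_nat n + a) powr s)
          \<le> (4 * exp (norm s) * norm s) * norm ((of_nat n + a) powr s / of_nat n)"
    \<comment> \<open>The threshold ensures \<open>Re w > 0\<close>, \<open>norm w > 2\<close> and \<open>norm w \<ge> n / 2\<close>.\<close>
    using eventually_ge_at_top[of "nat \<lceil>2 * norm a\<rceil> + 5"]
  proof eventually_elim
    case (elim n)
    define w where "w = of_nat n + a"
    define x where "x = s * Ln (1 + 1 / w)"
    have n: "real n \<ge> 2 * norm a + 5" using elim by linarith
    have "norm (of_nat n :: complex) \<le> norm w + norm a"
      unfolding w_def by (metis add_diff_cancel_right' norm_triangle_ineq4)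
    hence norm_w: "norm w > 2" "norm w \<ge> n / 2"
      using n norm_ge_zero[of a] by (auto simp del: norm_ge_zero)
    have Re_w: "Re w > 0"
      using abs_Re_le_cmod[of a] n norm_ge_zero[of a] unfolding w_def
      by (simp del: norm_ge_zero)
    have inv_w: "norm (1 / w) < 1 / 2" using norm_w(1) by (simp add: norm_divide divide_less_eq)
    have Re_1: "Re (1 + 1 / w) > 0"
      using abs_Re_le_cmod[of "1 / w"] inv_w by (simp only: plus_complex.sel one_complex.sel)
    have w0: "w \<noteq> 0" "1 + 1 / w \<noteq> 0" using Re_w Re_1 by (metis less_irrefl zero_complex.sel(1))+
    have "Ln (w * (1 + 1 / w)) = Ln w + Ln (1 + 1 / w)"
      using Re_Ln_pos_lt_imp[OF Re_w] Re_Ln_pos_lt_imp[OF Re_1] w0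
      by (intro Ln_times_simple) (auto simp: abs_less_iff)
    moreover have "w * (1 + 1 / w) = w + 1" using w0 by (simp add: field_simps)
    ultimately have Ln_Suc: "Ln (w + 1) = Ln w + Ln (1 + 1 / w)" by simp
    have "w + 1 \<noteq> 0" using Re_w by (auto simp: complex_eq_iff)
    hence ratio: "(w + 1) powr s - w powr s = w powr s * (exp x - 1)"
      using w0 by (simp add: powr_def Ln_Suc x_def distrib_left right_diff_distrib exp_add)
    have "norm (Ln (1 + 1 / w)) \<le> 2 * norm (1 / w)" by (rule norm_Ln_le[OF inv_w])
    also have "\<dots> \<le> 4 / n"
    proof -
      have "n > 0" using n norm_ge_zero[of a] by linarith
      hence "1 / norm w \<le> 1 / (n / 2)" using norm_w by (intro frac_le) auto
      thus ?thesis by (simp add: norm_divide)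
    qed
    finally have Ln_le: "norm (Ln (1 + 1 / w)) \<le> 4 / n" .
    have "norm (Ln (1 + 1 / w)) \<le> 1"
      using norm_Ln_le[OF inv_w] inv_w by linarith
    hence x_le: "norm x \<le> norm s" "norm x \<le> norm s * (4 / n)"
      unfolding x_def norm_mult by (intro mult_left_le mult_left_mono Ln_le norm_ge_zero; assumption)+
    have "norm (exp x - 1) \<le> exp (norm x) * norm x"
      using Taylor_exp_field[of x 0] by simp
    also have "\<dots> \<le> exp (norm s) * (norm s * (4 / n))"
      using x_le by (intro mult_mono) auto
    finally have "norm (w powr s) * norm (exp x - 1)
        \<le> norm (w powr s) * (exp (norm s) * (norm s * (4 / n)))"
      by (rule mult_left_mono) auto
    hence "norm ((w + 1) powr s - w powr s)
        \<le> (4 * exp (norm s) * norm s) * norm (w powr s / of_nat n)"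
      unfolding ratio by (simp add: norm_mult norm_divide mult_ac)
    moreover have "of_nat (Suc n) + a = w + 1" "of_nat n + a = w" by (simp_all add: w_def)
    ultimately show ?case by (simp only:)
  qed
qed

section \<open>Convergence of the Lerch series\<close>

lemma lerch_term_bigtheta:
  "(\<lambda>n. norm (lerch_term z s a n)) \<in> \<Theta>(\<lambda>n. norm z ^ n * real n powr (- Re s))"
  using landau_theta.mult[OF bigthetaI_cong[of "\<lambda>n. norm z ^ n" "\<lambda>n. norm z ^ n"] powr_shift_bigtheta[of a "- s"]]
  by (simp add: lerch_term_def norm_mult norm_power)

lemma summable_norm_lerch_term:
  assumes "norm z < 1 \<or> norm z = 1 \<and> Re s > 1"
  shows "summable (\<lambda>n. norm (lerch_term z s a n))"
proof -
  have "\<exists>p < -1. (\<lambda>n. norm z ^ n * real n powr (- Re s)) \<in> O(\<lambda>n. real n powr p)"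
    using assms
  proof
    assume z: "norm z < 1"
    \<comment> \<open>Replacing \<open>norm z\<close> by a positive \<open>q < 1\<close> covers \<open>z = 0\<close> as well.\<close>
    define q where "q = (1 + norm z) / 2"
    have q: "0 < q" "q < 1" "norm z \<le> q" using z by (auto simp: q_def intro: add_pos_nonneg)
    have "(\<lambda>n. norm z ^ n * real n powr (- Re s)) \<in> O(\<lambda>n. q ^ n * real n powr (- Re s))"
      using q by (intro landau_o.big.mult landau_o.big_refl bigoI[of _ 1])
        (auto intro!: always_eventually power_mono)
    also have "(\<lambda>n. q ^ n * real n powr (- Re s)) \<in> O(\<lambda>n. real n powr (-2))"
      using q by real_asymp
    finally show ?thesis by (intro exI[of _ "-2"]) auto
  next
    assume "norm z = 1 \<and> Re s > 1"
    thus ?thesis by (intro exI[of _ "- Re s"]) auto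
  qed
  then obtain p where p: "p < -1" "(\<lambda>n. norm z ^ n * real n powr (- Re s)) \<in> O(\<lambda>n. real n powr p)"
    by blast
  have "(\<lambda>n. norm (lerch_term z s a n)) \<in> O(\<lambda>n. real n powr p)"
    using lerch_term_bigtheta p(2) by (rule landau_o.big.bigtheta_trans2)
  thus ?thesis
    by (rule summable_comparison_test_bigo[rotated]) (use p in \<open>simp add: summable_real_powr_iff\<close>)
qed

text \<open>
  Summation by parts: \<open>(z - 1) * z ^ n * d n\<close> is the increment of the null sequence
  \<open>z ^ n * d n\<close> minus \<open>z ^ Suc n * (d (Suc n) - d n)\<close>, and the latter has order
  \<open>n powr (- Re s - 1)\<close>.
\<close>
lemma summable_lerch_term_unit_circle:
  assumes z: "norm z = 1" "z \<noteq> 1" and s: "Re s > 0"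
  shows "summable (lerch_term z s a)"
proof -
  let ?d = "\<lambda>n. (of_nat n + a) powr (- s)"
  have "(\<lambda>n. norm (lerch_term z s a n)) \<in> O(\<lambda>n. norm z ^ n * real n powr (- Re s))"
    using lerch_term_bigtheta by blast
  also have "(\<lambda>n. norm z ^ n * real n powr (- Re s)) \<in> o(\<lambda>_. 1)"
    unfolding z using s by real_asymp
  finally have "(\<lambda>n. norm (lerch_term z s a n)) \<longlonglongrightarrow> 0"
    by (auto dest: smalloD_tendsto)
  hence lim: "lerch_term z s a \<longlonglongrightarrow> 0" by (simp add: tendsto_norm_zero_iff)
  have "(\<lambda>n. ?d (Suc n) - ?d n) \<in> O(\<lambda>n. ?d n / of_nat n)"
    by (rule powr_shift_slowly_varying)
  hence "(\<lambda>n. norm (?d (Suc n) - ?d n)) \<in> O(\<lambda>n. norm (?d n) / real n)"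
    by (subst (asm) landau_o.big.norm_iff [symmetric]) (simp add: norm_divide)
  also have "(\<lambda>n. norm (?d n) / real n) \<in> O(\<lambda>n. real n powr (- Re s) / real n)"
    using powr_shift_bigtheta[of a "- s"] by (intro landau_o.big.divide_right) auto
  also have "(\<lambda>n. real n powr (- Re s) / real n) \<in> O(\<lambda>n. real n powr (- Re s - 1))"
    by real_asymp
  finally have "summable (\<lambda>n. norm (?d (Suc n) - ?d n))"
    by (rule summable_comparison_test_bigo[rotated])
       (use s in \<open>simp add: summable_real_powr_iff\<close>)
  hence "summable (\<lambda>n. norm (z ^ Suc n * (?d (Suc n) - ?d n)))"
    using z by (simp add: norm_mult norm_power)
  hence "summable (\<lambda>n. z ^ Suc n * (?d (Suc n) - ?d n))"
    by (rule summable_norm_cancel)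
  from summable_diff[OF telescope_summable[OF lim] this]
  have "summable (\<lambda>n. (z - 1) * lerch_term z s a n)"
    by (simp add: lerch_term_def algebra_simps)
  thus ?thesis using z by simp
qed

section \<open>The augmented series\<close>

lemma lerch_term_mult_shift:
  assumes "a \<notin> \<int>\<^sub>\<le>\<^sub>0"
  shows "(of_nat r + a) ^ m * lerch_term z s a r = lerch_term z (s - of_nat m) a r"
proof -
  have "of_nat r + a \<noteq> 0"
    using assms minus_of_nat_in_nonpos_Ints[of r] by (auto simp: add_eq_0_iff)
  thus ?thesis
    by (simp add: lerch_term_def powr_diff powr_minus field_simps)
qed

text \<open>
  The coefficients are those of \<open>\<alpha> * r\<^sup>2 + \<beta> * r + 1\<close> re-expanded at \<open>r = - a\<close>.
\<close>
lemma aug_H_term_eq: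
  assumes "a \<notin> \<int>\<^sub>\<le>\<^sub>0"
  shows "aug_H_term k z s a r =
     of_real (aug_alpha k) * lerch_term z (s - 2) a r
     + (of_real (aug_beta k) - 2 * a * of_real (aug_alpha k)) * lerch_term z (s - 1) a r
     + (1 - a * of_real (aug_beta k) + a ^ 2 * of_real (aug_alpha k)) * lerch_term z s a r"
proof -
  have "aug_H_term k z s a r = of_real (aug_tri (r + 1) k) * lerch_term z s a r"
    by (simp add: aug_H_term_def lerch_term_def)
  moreover have "lerch_term z (s - 2) a r = (of_nat r + a) ^ 2 * lerch_term z s a r"
    "lerch_term z (s - 1) a r = (of_nat r + a) * lerch_term z s a r"
    using lerch_term_mult_shift[OF assms, of r 2 z s] lerch_term_mult_shift[OF assms, of r 1 z s]
    by simp_all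
  ultimately show ?thesis
    by (simp add: aug_tri_def power2_eq_square algebra_simps)
qed

lemma aug_tri_bigtheta: "(\<lambda>n. aug_tri (n + 1) k) \<in> \<Theta>(\<lambda>n. real n ^ 2)"
proof -
  have "aug_alpha k > 0" "aug_beta k > 0" by (auto simp: aug_alpha_def aug_beta_def)
  thus ?thesis unfolding aug_tri_def by real_asymp
qed

lemma aug_tri_slowly_varying:
  "(\<lambda>n. aug_tri (Suc n + 1) k - aug_tri (n + 1) k) \<in> O(\<lambda>n. aug_tri (n + 1) k / real n)"
proof -
  have "aug_alpha k > 0" "aug_beta k > 0" by (auto simp: aug_alpha_def aug_beta_def)
  thus ?thesis unfolding aug_tri_def by real_asymp
qed

lemma aug_H_term_bigtheta:
  "(\<lambda>n. norm (aug_H_term k z s a n)) \<in> \<Theta>(\<lambda>n. norm z ^ n * real n powr (2 - Re s))"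
proof -
  have "(\<lambda>n. norm (aug_tri (n + 1) k) * norm (lerch_term z s a n))
      \<in> \<Theta>(\<lambda>n. real n ^ 2 * (norm z ^ n * real n powr (- Re s)))"
    using aug_tri_bigtheta by (intro landau_theta.mult lerch_term_bigtheta) auto
  also have "(\<lambda>n. norm (aug_tri (n + 1) k) * norm (lerch_term z s a n)) =
      (\<lambda>n. norm (aug_H_term k z s a n))"
    by (simp add: aug_H_term_def lerch_term_def norm_mult mult_ac)
  also have "(\<lambda>n. real n ^ 2 * (norm z ^ n * real n powr (- Re s))) \<in>
      \<Theta>(\<lambda>n. norm z ^ n * real n powr (2 - Re s))"
    by (intro bigthetaI_cong eventually_mono[OF eventually_gt_at_top[of 0]])
       (auto simp: powr_diff powr_minus divide_simps simp flip: powr_numeral)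
  finally show ?thesis .
qed

text \<open>
  In this region \<open>norm z ^ n * n powr (2 - Re s)\<close>, the order of the terms, is eventually at least 1.
\<close>
lemma not_summable_aug_H_term:
  assumes "norm z > 1 \<or> norm z = 1 \<and> Re s \<le> 2"
  shows "\<not> summable (aug_H_term k z s a)"
proof
  assume "summable (aug_H_term k z s a)"
  hence "(\<lambda>n. norm (aug_H_term k z s a n)) \<in> o(\<lambda>_. 1)"
    by (intro smalloI_tendsto) (auto dest: summable_LIMSEQ_zero intro: tendsto_norm_zero)
  with aug_H_term_bigtheta[of k z s a]
  have "(\<lambda>n. norm z ^ n * real n powr (2 - Re s)) \<in> o(\<lambda>_. 1)"
    by (simp add: landau_o.small.in_cong_bigtheta)
  hence lim: "(\<lambda>n. norm z ^ n * real n powr (2 - Re s)) \<longlonglongrightarrow> 0"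
    by (auto dest: smalloD_tendsto)
  have "\<forall>\<^sub>F n in sequentially. norm z ^ n * real n powr (2 - Re s) \<ge> 1"
    using assms
  proof
    assume "norm z > 1"
    moreover have "filterlim (\<lambda>n. q ^ n * real n powr p) at_top sequentially"
      if "q > 1" for p q :: real
      using that by real_asymp
    ultimately have "filterlim (\<lambda>n. norm z ^ n * real n powr (2 - Re s)) at_top sequentially"
      by blast
    thus ?thesis by (simp add: filterlim_at_top)
  next
    assume "norm z = 1 \<and> Re s \<le> 2"
    thus ?thesis
      by (intro eventually_mono[OF eventually_gt_at_top[of 0]]) (auto intro: ge_one_powr_ge_zero)
  qed
  from tendsto_lowerbound[OF lim this] show False by simp
qed

text \<open>
  At \<open>z = 1\<close> the terms are a product of two slowly varying factors, and \<open>n\<close> times the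
  \<open>n\<close>-th term has order \<open>n powr (3 - Re s)\<close>. The case \<open>Re s = 3\<close>, where the terms may behave
  like \<open>1 / n\<close> times a rotating phase, is thus treated like the others.
\<close>
lemma not_summable_aug_H_term_at_1:
  assumes "Re s \<le> 3"
  shows "\<not> summable (aug_H_term k 1 s a)"
proof
  let ?A = "\<lambda>n. complex_of_real (aug_tri (n + 1) k)"
  assume "summable (aug_H_term k 1 s a)"
  moreover have "(\<lambda>n. ?A (Suc n) - ?A n) \<in> O(\<lambda>n. ?A n / of_nat n)"
  proof -
    have "(\<lambda>n. complex_of_real (aug_tri (Suc n + 1) k - aug_tri (n + 1) k))
        \<in> O(\<lambda>n. complex_of_real (aug_tri (n + 1) k / real n))"
      using aug_tri_slowly_varying by (subst landau_o.big.of_real_iff)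
    thus ?thesis by simp
  qed
  from slowly_varying_mult[OF this powr_shift_slowly_varying[of a "- s"]]
  have "(\<lambda>n. aug_H_term k 1 s a (Suc n) - aug_H_term k 1 s a n)
      \<in> O(\<lambda>n. aug_H_term k 1 s a n / of_nat n)"
    by (simp add: aug_H_term_def)
  ultimately have "(\<lambda>n. of_nat n * aug_H_term k 1 s a n) \<longlonglongrightarrow> 0"
    by (rule slowly_varying_summable_imp)
  hence "(\<lambda>n. real n * norm (aug_H_term k 1 s a n)) \<in> o(\<lambda>_. 1)"
    using tendsto_norm_zero by (intro smalloI_tendsto) (force simp: norm_mult)+
  moreover have "(\<lambda>n. real n * norm (aug_H_term k 1 s a n)) \<in> \<Theta>(\<lambda>n. real n * real n powr (2 - Re s))"
    using aug_H_term_bigtheta[of k 1 s a] by (intro landau_theta.mult) auto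
  ultimately have "(\<lambda>n. real n * real n powr (2 - Re s)) \<in> o(\<lambda>_. 1)"
    by (simp add: landau_o.small.in_cong_bigtheta)
  hence "(\<lambda>n. real n * real n powr (2 - Re s)) \<longlonglongrightarrow> 0"
    by (auto dest: smalloD_tendsto)
  moreover have "\<forall>\<^sub>F n in sequentially. real n * real n powr (2 - Re s) \<ge> 1"
    using eventually_gt_at_top[of 0]
  proof eventually_elim
    case (elim n)
    have "real n powr (3 - Re s) \<ge> 1" using assms elim by (intro ge_one_powr_ge_zero) auto
    also have "real n powr (3 - Re s) = real n powr (1 + (2 - Re s))" by simp
    finally show ?case using elim by (subst (asm) powr_add) simp
  qed
  ultimately have "(0::real) \<ge> 1" by (rule tendsto_lowerbound) simp
  thus False by simp
qed

theorem theorem3p2: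
  fixes k :: nat and a z s :: complex
  assumes "a \<notin> \<int>\<^sub>\<le>\<^sub>0"
  shows "(summable (aug_H_term k z s a) \<longleftrightarrow>
            cmod z < 1 \<or> (z = 1 \<and> Re s > 3) \<or> (cmod z = 1 \<and> z \<noteq> 1 \<and> Re s > 2)) \<and>
         (summable (aug_H_term k z s a) \<longrightarrow>
            summable (lerch_term z (s - 2) a) \<and>
            summable (lerch_term z (s - 1) a) \<and>
            summable (lerch_term z s a) \<and>
            aug_H k z s a =
              of_real (aug_alpha k) * lerch_phi z (s - 2) a
              + (of_real (aug_beta k) - 2 * a * of_real (aug_alpha k)) * lerch_phi z (s - 1) a
              + (1 - a * of_real (aug_beta k) + a ^ 2 * of_real (aug_alpha k)) * lerch_phi z s a)"
proof -
  define region where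
    "region \<longleftrightarrow> cmod z < 1 \<or> (z = 1 \<and> Re s > 3) \<or> (cmod z = 1 \<and> z \<noteq> 1 \<and> Re s > 2)"
  have lerch: "summable (lerch_term z (s - of_nat m) a)" if region "m \<le> 2" for m
  proof (cases "cmod z = 1 \<and> z \<noteq> 1")
    case True
    thus ?thesis using that by (intro summable_lerch_term_unit_circle) (auto simp: region_def)
  next
    case False
    thus ?thesis using that
      by (intro summable_norm_cancel[OF summable_norm_lerch_term]) (auto simp: region_def)
  qed
  have L: "summable (lerch_term z (s - 2) a)" "summable (lerch_term z (s - 1) a)"
    "summable (lerch_term z s a)" if region
    using lerch[OF that, of 2] lerch[OF that, of 1] lerch[OF that, of 0] by simp_all
  note H = aug_H_term_eq[OF assms, of k z s]
  have sums: "aug_H_term k z s a sums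
      (of_real (aug_alpha k) * lerch_phi z (s - 2) a
       + (of_real (aug_beta k) - 2 * a * of_real (aug_alpha k)) * lerch_phi z (s - 1) a
       + (1 - a * of_real (aug_beta k) + a ^ 2 * of_real (aug_alpha k)) * lerch_phi z s a)"
    if region
    unfolding lerch_phi_def H [abs_def]
    by (intro sums_add sums_mult summable_sums L that)
  have region if "summable (aug_H_term k z s a)"
    using that not_summable_aug_H_term[of z s k a] not_summable_aug_H_term_at_1[of s k a]
    unfolding region_def by fastforce
  hence "summable (aug_H_term k z s a) \<longleftrightarrow> region"
    using sums by (auto simp: sums_iff)
  thus ?thesis
    using L sums unfolding region_def aug_H_def by (simp add: sums_iff)
qed

end
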